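(* Let $X$ be a simply connected, locally path connected Hausdorff space, let $G$ be a compact Hausdorff group, let $\Gamma$ be a discrete group acting on $X$ from the left freely and properly discontinuously, and let $\phi:\Gamma\to G$ be a group morphism such that the composition $\Gamma\xrightarrow{\phi}G\to\pi_0(G)$ is a group monomorphism. Let $\Gamma$ act on $X\times G$ by $\gamma\cdot(x,g)=(\gamma x,\phi(\gamma)g)$, and let $E:=\Gamma\backslash(X\times G)$ with the right $G$-action induced by right translation on the $G$ factor, regarded as a principal $G$-bundle over $Y:=\Gamma\backslash X$. Then the bundle $E\to Y$ is incompressible.
   Context: The action of $\Gamma$ on $X$ is properly discontinuous if every point of $X$ has an open neighbourhood $U$ with $\gamma U\cap U=\emptyset$ for all $\gamma\in\Gamma$, $\gamma\neq1$. $G_a$ denotes the normal subgroup of $G$ of elements joined to the identity by a continuous path in $G$, and $\pi_0(G):=G/G_a$ as an abstract group. The projection $E\to Y$ is induced by the first projection $X\times G\to X$. A principal $G$-bundle over $Y$ is incompressible if its restriction (pullback) to every non-nullhomotopic loop in $Y$ is a non-trivial bundle (over the circle). *)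

theory Defs
  imports "HOL-Analysis.Analysis" "HOL-Algebra.Group_Action"
begin

section \<open>Loops\<close>

abbreviation circle :: "complex topology" where
  "circle \<equiv> top_of_set (sphere 0 1)"

definition nullhomotopic :: "'a topology \<Rightarrow> 'b topology \<Rightarrow> ('a \<Rightarrow> 'b) \<Rightarrow> bool" where
  "nullhomotopic X Y f \<longleftrightarrow> (\<exists>c. homotopic_with (\<lambda>_. True) X Y f (\<lambda>_. c))"

text \<open>The library's \<^const>\<open>simply_connected\<close> is about subsets of a type in class
  \<^class>\<open>topological_space\<close>; this is the notion for abstract topologies. Homotopies of
  loops are free, which for nullhomotopy is the same as keeping the base point fixed.\<close>

definition simply_connected_space :: "'a topology \<Rightarrow> bool" where
  "simply_connected_space X \<longleftrightarrow>
     path_connected_space X \<and> (\<forall>f. continuous_map circle X f \<longrightarrow> nullhomotopic circle X f)"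


section \<open>Topological groups\<close>

definition topological_group :: "('g, 'm) monoid_scheme \<Rightarrow> 'g topology \<Rightarrow> bool" where
  "topological_group G T \<longleftrightarrow>
     group G \<and> topspace T = carrier G \<and>
     continuous_map (prod_topology T T) T (\<lambda>(x, y). x \<otimes>\<^bsub>G\<^esub> y) \<and>
     continuous_map T T (\<lambda>x. inv\<^bsub>G\<^esub> x)"

definition identity_path_component :: "('g, 'm) monoid_scheme \<Rightarrow> 'g topology \<Rightarrow> 'g set" where
  "identity_path_component G T = {g \<in> carrier G. \<exists>p. pathin T p \<and> p 0 = \<one>\<^bsub>G\<^esub> \<and> p 1 = g}"

definition pi0_group :: "('g, 'm) monoid_scheme \<Rightarrow> 'g topology \<Rightarrow> 'g set monoid" where
  "pi0_group G T = G Mod identity_path_component G T"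

definition pi0_proj :: "('g, 'm) monoid_scheme \<Rightarrow> 'g topology \<Rightarrow> 'g \<Rightarrow> 'g set" where
  "pi0_proj G T g = identity_path_component G T #>\<^bsub>G\<^esub> g"


section \<open>Group actions on spaces and orbit spaces\<close>

definition continuous_action ::
    "('c, 'm) monoid_scheme \<Rightarrow> 'x topology \<Rightarrow> ('c \<Rightarrow> 'x \<Rightarrow> 'x) \<Rightarrow> bool" where
  "continuous_action \<Gamma> X a \<longleftrightarrow>
     group_action \<Gamma> (topspace X) a \<and> (\<forall>\<gamma>\<in>carrier \<Gamma>. continuous_map X X (a \<gamma>))"

definition free_action ::
    "('c, 'm) monoid_scheme \<Rightarrow> 'x topology \<Rightarrow> ('c \<Rightarrow> 'x \<Rightarrow> 'x) \<Rightarrow> bool" where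
  "free_action \<Gamma> X a \<longleftrightarrow>
     (\<forall>\<gamma>\<in>carrier \<Gamma>. \<forall>x\<in>topspace X. a \<gamma> x = x \<longrightarrow> \<gamma> = \<one>\<^bsub>\<Gamma>\<^esub>)"

definition properly_discontinuous ::
    "('c, 'm) monoid_scheme \<Rightarrow> 'x topology \<Rightarrow> ('c \<Rightarrow> 'x \<Rightarrow> 'x) \<Rightarrow> bool" where
  "properly_discontinuous \<Gamma> X a \<longleftrightarrow>
     (\<forall>x\<in>topspace X. \<exists>U. openin X U \<and> x \<in> U \<and>
        (\<forall>\<gamma>\<in>carrier \<Gamma>. \<gamma> \<noteq> \<one>\<^bsub>\<Gamma>\<^esub> \<longrightarrow> a \<gamma> ` U \<inter> U = {}))"

definition quotient_topology :: "'x topology \<Rightarrow> ('x \<Rightarrow> 'y) \<Rightarrow> 'y topology" where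
  "quotient_topology X q =
     topology (\<lambda>V. V \<subseteq> q ` topspace X \<and> openin X {x \<in> topspace X. q x \<in> V})"

lemma openin_quotient_topology:
  "openin (quotient_topology X q) V \<longleftrightarrow>
     V \<subseteq> q ` topspace X \<and> openin X {x \<in> topspace X. q x \<in> V}"
proof -
  have "istopology (\<lambda>V. V \<subseteq> q ` topspace X \<and> openin X {x \<in> topspace X. q x \<in> V})"
    unfolding istopology_def
  proof (intro conjI allI impI; (elim conjE)?)
    fix S T
    assume "openin X {x \<in> topspace X. q x \<in> S}" "openin X {x \<in> topspace X. q x \<in> T}"
    moreover have "{x \<in> topspace X. q x \<in> S \<inter> T} =
        {x \<in> topspace X. q x \<in> S} \<inter> {x \<in> topspace X. q x \<in> T}" by blast
    ultimately show "openin X {x \<in> topspace X. q x \<in> S \<inter> T}" by auto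
  next
    fix \<K>
    assume *: "\<forall>K\<in>\<K>. K \<subseteq> q ` topspace X \<and> openin X {x \<in> topspace X. q x \<in> K}"
    have "{x \<in> topspace X. q x \<in> \<Union>\<K>} = (\<Union>K\<in>\<K>. {x \<in> topspace X. q x \<in> K})" by blast
    with * show "openin X {x \<in> topspace X. q x \<in> \<Union>\<K>}" by auto
  qed auto
  then show ?thesis
    unfolding quotient_topology_def by (simp only: topology_inverse')
qed

lemma topspace_quotient_topology [simp]: "topspace (quotient_topology X q) = q ` topspace X"
proof
  show "topspace (quotient_topology X q) \<subseteq> q ` topspace X"
    using openin_topspace[of "quotient_topology X q"] unfolding openin_quotient_topology by simp
  have "{x \<in> topspace X. q x \<in> q ` topspace X} = topspace X" by blast
  then have "openin (quotient_topology X q) (q ` topspace X)"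
    by (simp add: openin_quotient_topology)
  then show "q ` topspace X \<subseteq> topspace (quotient_topology X q)"
    by (rule openin_subset)
qed

lemma quotient_map_quotient_topology: "quotient_map X (quotient_topology X q) q"
  unfolding quotient_map_def by (simp add: openin_quotient_topology)

definition orbit_space ::
    "('c, 'm) monoid_scheme \<Rightarrow> 'x topology \<Rightarrow> ('c \<Rightarrow> 'x \<Rightarrow> 'x) \<Rightarrow> 'x set topology" where
  "orbit_space \<Gamma> X a = quotient_topology X (orbit \<Gamma> a)"

lemma topspace_orbit_space: "topspace (orbit_space \<Gamma> X a) = orbits \<Gamma> (topspace X) a"
  unfolding orbit_space_def orbits_def topspace_quotient_topology by blast


section \<open>Principal bundles\<close>

record ('e, 'b, 'g) gbundle =
  total_space :: "'e topology"
  base_space :: "'b topology"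
  bundle_proj :: "'e \<Rightarrow> 'b"
  right_act :: "'e \<Rightarrow> 'g \<Rightarrow> 'e"

definition pullback_bundle ::
    "'c topology \<Rightarrow> ('c \<Rightarrow> 'b) \<Rightarrow> ('e, 'b, 'g) gbundle \<Rightarrow> ('c \<times> 'e, 'c, 'g) gbundle" where
  "pullback_bundle C f P =
     \<lparr>total_space = subtopology (prod_topology C (total_space P)) {(c, e). f c = bundle_proj P e},
      base_space = C,
      bundle_proj = fst,
      right_act = (\<lambda>(c, e) g. (c, right_act P e g))\<rparr>"

definition restrict_bundle :: "('e, 'b, 'g) gbundle \<Rightarrow> 'b set \<Rightarrow> ('e, 'b, 'g) gbundle" where
  "restrict_bundle P U =
     P\<lparr>total_space := subtopology (total_space P) {e. bundle_proj P e \<in> U},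
       base_space := subtopology (base_space P) U\<rparr>"

definition trivial_bundle ::
    "('g, 'm) monoid_scheme \<Rightarrow> 'g topology \<Rightarrow> ('e, 'b, 'g) gbundle \<Rightarrow> bool" where
  "trivial_bundle G T P \<longleftrightarrow>
     (\<exists>h. homeomorphic_map (prod_topology (base_space P) T) (total_space P) h \<and>
        (\<forall>b\<in>topspace (base_space P). \<forall>g\<in>carrier G.
           bundle_proj P (h (b, g)) = b \<and>
           (\<forall>k\<in>carrier G. right_act P (h (b, g)) k = h (b, g \<otimes>\<^bsub>G\<^esub> k))))"

text \<open>Principal bundles are locally trivial; that the action is free and transitive on the
  fibres follows from local triviality.\<close>

definition principal_bundle ::
    "('g, 'm) monoid_scheme \<Rightarrow> 'g topology \<Rightarrow> ('e, 'b, 'g) gbundle \<Rightarrow> bool" where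
  "principal_bundle G T P \<longleftrightarrow>
     topological_group G T \<and>
     continuous_map (total_space P) (base_space P) (bundle_proj P) \<and>
     continuous_map (prod_topology (total_space P) T) (total_space P) (\<lambda>(e, g). right_act P e g) \<and>
     (\<forall>e\<in>topspace (total_space P). right_act P e \<one>\<^bsub>G\<^esub> = e \<and>
        (\<forall>g\<in>carrier G. bundle_proj P (right_act P e g) = bundle_proj P e \<and>
           (\<forall>k\<in>carrier G. right_act P (right_act P e g) k = right_act P e (g \<otimes>\<^bsub>G\<^esub> k)))) \<and>
     (\<forall>b\<in>topspace (base_space P). \<exists>U. openin (base_space P) U \<and> b \<in> U \<and>
        trivial_bundle G T (restrict_bundle P U))"

definition incompressible_bundle ::
    "('g, 'm) monoid_scheme \<Rightarrow> 'g topology \<Rightarrow> ('e, 'b, 'g) gbundle \<Rightarrow> bool" where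
  "incompressible_bundle G T P \<longleftrightarrow>
     principal_bundle G T P \<and>
     (\<forall>f. continuous_map circle (base_space P) f \<and> \<not> nullhomotopic circle (base_space P) f \<longrightarrow>
        \<not> trivial_bundle G T (pullback_bundle circle f P))"


section \<open>The bundle associated with a group morphism\<close>

text \<open>The restriction makes the action extensional, as \<^locale>\<open>group_action\<close> requires.\<close>

definition diag_action ::
    "('g, 'm) monoid_scheme \<Rightarrow> 'x topology \<Rightarrow> ('c \<Rightarrow> 'x \<Rightarrow> 'x) \<Rightarrow> ('c \<Rightarrow> 'g) \<Rightarrow>
     'c \<Rightarrow> 'x \<times> 'g \<Rightarrow> 'x \<times> 'g" where
  "diag_action G X a \<phi> \<gamma> =
     (\<lambda>(x, g) \<in> topspace X \<times> carrier G. (a \<gamma> x, \<phi> \<gamma> \<otimes>\<^bsub>G\<^esub> g))"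

text \<open>Points of the total space and of the base are orbits, that is, sets. The map induced on
  orbits by an equivariant map is taking images: the orbit of \<open>(x, g)\<close> has first projection
  the orbit of \<open>x\<close>, and its right translate by \<open>k\<close> is the orbit of \<open>(x, g k)\<close>.\<close>

definition associated_bundle ::
    "('c, 'n) monoid_scheme \<Rightarrow> ('g, 'm) monoid_scheme \<Rightarrow> 'g topology \<Rightarrow> 'x topology \<Rightarrow>
     ('c \<Rightarrow> 'x \<Rightarrow> 'x) \<Rightarrow> ('c \<Rightarrow> 'g) \<Rightarrow> (('x \<times> 'g) set, 'x set, 'g) gbundle" where
  "associated_bundle \<Gamma> G T X a \<phi> =
     \<lparr>total_space = orbit_space \<Gamma> (prod_topology X T) (diag_action G X a \<phi>),
      base_space = orbit_space \<Gamma> X a,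
      bundle_proj = (\<lambda>S. fst ` S),
      right_act = (\<lambda>S k. (\<lambda>(x, g). (x, g \<otimes>\<^bsub>G\<^esub> k)) ` S)\<rparr>"

end

theory Submission
  imports Defs
begin

text \<open>A trivialisation of the pullback along a loop \<open>f\<close> in \<open>Y\<close> gives a section, that is, a loop in \<open>E\<close>
  over \<open>f\<close>. Since \<open>X \<times> G \<rightarrow> E\<close> is a covering, that loop lifts to a path \<open>(q, u)\<close> in \<open>X \<times> G\<close> whose end
  points differ by some \<open>\<gamma> \<in> \<Gamma>\<close>. The second component joins \<open>u 0\<close> to \<open>\<phi> \<gamma> (u 0)\<close> in \<open>G\<close>, so \<open>\<phi> \<gamma>\<close>
  lies in the path component of the identity and \<open>\<gamma> = 1\<close> by injectivity on \<open>\<pi>\<^sub>0(G)\<close>. Hence \<open>q\<close> is a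
  loop in the simply connected space \<open>X\<close> lifting \<open>f\<close>, and \<open>f\<close> is nullhomotopic.\<close>

section \<open>Coverings from properly discontinuous actions\<close>

lemma open_map_prod_left:
  assumes "open_map X Y f"
  shows "open_map (prod_topology X T) (prod_topology Y T) (\<lambda>(x, t). (f x, t))"
  unfolding open_map_def
proof (intro allI impI)
  fix W assume W: "openin (prod_topology X T) W"
  show "openin (prod_topology Y T) ((\<lambda>(x, t). (f x, t)) ` W)"
    unfolding openin_prod_topology_alt
  proof (intro allI impI)
    fix y t assume "(y, t) \<in> (\<lambda>(x, t). (f x, t)) ` W"
    then obtain x where x: "(x, t) \<in> W" "y = f x" by auto
    then obtain U V where "openin X U" "openin T V" "x \<in> U" "t \<in> V" "U \<times> V \<subseteq> W"
      using W unfolding openin_prod_topology_alt by meson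
    then show "\<exists>U V. openin Y U \<and> openin T V \<and> y \<in> U \<and> t \<in> V \<and>
        U \<times> V \<subseteq> (\<lambda>(x, t). (f x, t)) ` W"
      using assms x unfolding open_map_def
      by (intro exI[of _ "f ` U"] exI[of _ V]) force
  qed
qed

lemma group_actionI:
  assumes "group \<Gamma>"
    and ext: "\<And>\<gamma>. \<gamma> \<in> carrier \<Gamma> \<Longrightarrow> a \<gamma> \<in> extensional E"
    and closed: "\<And>\<gamma> z. \<gamma> \<in> carrier \<Gamma> \<Longrightarrow> z \<in> E \<Longrightarrow> a \<gamma> z \<in> E"
    and one: "\<And>z. z \<in> E \<Longrightarrow> a \<one>\<^bsub>\<Gamma>\<^esub> z = z"
    and mult: "\<And>\<gamma> \<delta> z. \<gamma> \<in> carrier \<Gamma> \<Longrightarrow> \<delta> \<in> carrier \<Gamma> \<Longrightarrow> z \<in> E \<Longrightarrow>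
      a (\<gamma> \<otimes>\<^bsub>\<Gamma>\<^esub> \<delta>) z = a \<gamma> (a \<delta> z)"
  shows "group_action \<Gamma> E a"
proof -
  interpret \<Gamma>: group \<Gamma> by fact
  have bij: "a \<gamma> \<in> Bij E" if \<gamma>: "\<gamma> \<in> carrier \<Gamma>" for \<gamma>
  proof -
    have "a (inv\<^bsub>\<Gamma>\<^esub> \<gamma>) (a \<gamma> z) = z" "a \<gamma> (a (inv\<^bsub>\<Gamma>\<^esub> \<gamma>) z) = z" if "z \<in> E" for z
      using that \<gamma> mult[symmetric] one by auto
    then have "bij_betw (a \<gamma>) E E"
      using \<gamma> closed by (intro bij_betwI[where g = "a (inv\<^bsub>\<Gamma>\<^esub> \<gamma>)"]) auto
    with ext[OF \<gamma>] show ?thesis by (simp add: Bij_def)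
  qed
  have "a (\<gamma> \<otimes>\<^bsub>\<Gamma>\<^esub> \<delta>) = compose E (a \<gamma>) (a \<delta>)" if "\<gamma> \<in> carrier \<Gamma>" "\<delta> \<in> carrier \<Gamma>" for \<gamma> \<delta>
    using that ext[of "\<gamma> \<otimes>\<^bsub>\<Gamma>\<^esub> \<delta>"] mult
    by (intro extensionalityI[of _ E]) (auto simp: compose_def)
  with bij have "a \<in> hom \<Gamma> (BijGroup E)"
    by (auto simp: hom_def BijGroup_def)
  then show ?thesis
    using \<Gamma>.is_group group_BijGroup
    by (simp add: group_action_def group_hom_def group_hom_axioms_def)
qed

locale properly_discontinuous_action =
  group_action \<Gamma> "topspace Z" a for \<Gamma> (structure) and Z :: "'z topology" and a +
  assumes continuous: "\<And>\<gamma>. \<gamma> \<in> carrier \<Gamma> \<Longrightarrow> continuous_map Z Z (a \<gamma>)"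
    and discontinuous: "properly_discontinuous \<Gamma> Z a"
begin

abbreviation proj :: "'z \<Rightarrow> 'z set" where "proj \<equiv> orbit \<Gamma> a"
abbreviation quot :: "'z set topology" where "quot \<equiv> orbit_space \<Gamma> Z a"

sublocale \<Gamma>: group \<Gamma>
  using group_hom group_hom.axioms(1) by blast

lemma proj_eq_iff:
  assumes "z \<in> topspace Z" "z' \<in> topspace Z"
  shows "proj z = proj z' \<longleftrightarrow> (\<exists>\<gamma>\<in>carrier \<Gamma>. z' = a \<gamma> z)"
proof
  assume "proj z = proj z'"
  with orbit_refl[OF assms(2)] show "\<exists>\<gamma>\<in>carrier \<Gamma>. z' = a \<gamma> z"
    by (auto simp: orbit_def)
next
  assume "\<exists>\<gamma>\<in>carrier \<Gamma>. z' = a \<gamma> z"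
  then obtain \<gamma> where \<gamma>: "\<gamma> \<in> carrier \<Gamma>" "z' = a \<gamma> z" by blast
  have "proj (a \<gamma> y) \<subseteq> proj y" if "\<gamma> \<in> carrier \<Gamma>" "y \<in> topspace Z" for \<gamma> y
    using that composition_rule[of y _ \<gamma>, symmetric] unfolding orbit_def by blast
  from this[OF \<gamma>(1) assms(1)] this[of "inv \<gamma>" z'] \<gamma> show "proj z = proj z'"
    using orbit_sym_aux[OF \<gamma>(1) assms(1)] assms by auto
qed

lemma proj_act: "\<gamma> \<in> carrier \<Gamma> \<Longrightarrow> z \<in> topspace Z \<Longrightarrow> proj (a \<gamma> z) = proj z"
  using proj_eq_iff element_image by metis

lemma topspace_quot: "topspace quot = proj ` topspace Z"
  by (simp add: orbit_space_def)

lemma quotient_map_proj: "quotient_map Z quot proj"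
  unfolding orbit_space_def by (rule quotient_map_quotient_topology)

lemma continuous_map_proj: "continuous_map Z quot proj"
  by (simp add: quotient_imp_continuous_map quotient_map_proj)

lemma open_map_proj: "open_map Z quot proj"
  unfolding open_map_def
proof (intro allI impI)
  fix U assume U: "openin Z U"
  then have sub: "U \<subseteq> topspace Z" by (rule openin_subset)
  have "{z \<in> topspace Z. proj z \<in> proj ` U} = (\<Union>\<gamma>\<in>carrier \<Gamma>. {z \<in> topspace Z. a \<gamma> z \<in> U})"
    (is "?L = ?R")
  proof
    show "?L \<subseteq> ?R" using proj_eq_iff sub by fastforce
    show "?R \<subseteq> ?L" using proj_act by blast
  qed
  moreover have "openin Z ?R"
    using U continuous by (auto intro!: openin_continuous_map_preimage)
  ultimately show "openin quot (proj ` U)"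
    using sub by (auto simp: orbit_space_def openin_quotient_topology)
qed

definition wandering :: "'z set \<Rightarrow> bool" where
  "wandering U \<longleftrightarrow> openin Z U \<and> (\<forall>\<gamma>\<in>carrier \<Gamma>. \<gamma> \<noteq> \<one> \<longrightarrow> a \<gamma> ` U \<inter> U = {})"

lemma wandering_neighbourhood:
  assumes "z \<in> topspace Z"
  obtains U where "wandering U" "z \<in> U"
  using discontinuous assms unfolding properly_discontinuous_def wandering_def by blast

lemma act_one: "z \<in> topspace Z \<Longrightarrow> a \<one> z = z"
  by (metis id_eq_one restrict_apply')

lemma inj_on_wandering:
  assumes "wandering U" shows "inj_on proj U"
proof (rule inj_onI)
  fix z z' assume z: "z \<in> U" "z' \<in> U" and eq: "proj z = proj z'"
  then have Z: "z \<in> topspace Z" "z' \<in> topspace Z"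
    using assms openin_subset by (auto simp: wandering_def)
  then obtain \<gamma> where \<gamma>: "\<gamma> \<in> carrier \<Gamma>" "z' = a \<gamma> z" using eq proj_eq_iff by blast
  then have "\<gamma> = \<one>" using assms z unfolding wandering_def by blast
  with \<gamma> Z show "z = z'" by (simp add: act_one)
qed

lemma local_section:
  assumes U: "wandering U"
  obtains \<sigma> where "homeomorphic_maps (subtopology Z U) (subtopology quot (proj ` U)) proj \<sigma>"
proof -
  have sub: "U \<subseteq> topspace Z" using U by (simp add: wandering_def openin_subset)
  have "homeomorphic_map (subtopology Z U) (subtopology quot (proj ` U)) proj"
  proof (rule bijective_open_imp_homeomorphic_map)
    show "continuous_map (subtopology Z U) (subtopology quot (proj ` U)) proj"
      using continuous_map_proj
      by (auto simp: continuous_map_in_subtopology continuous_map_from_subtopology)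
    show "open_map (subtopology Z U) (subtopology quot (proj ` U)) proj"
      using U by (intro open_map_into_subtopology open_map_from_subtopology open_map_proj)
        (auto simp: wandering_def)
  qed (use sub inj_on_wandering[OF U] in \<open>auto simp: topspace_quot Int_absorb1\<close>)
  then show thesis using that homeomorphic_map_maps by blast
qed

lemma path_lifting:
  assumes c: "pathin quot c" and z: "z \<in> topspace Z" "proj z = c 0"
  obtains w where "pathin Z w" "w 0 = z" "\<And>r. r \<in> {0..1} \<Longrightarrow> proj (w r) = c r"
proof -
  \<comment> \<open>Quantifying over the starting point \<open>z\<close> makes \<open>P\<close> transitive, as bisection of the interval needs.\<close>
  define P where "P u v \<longleftrightarrow> (0 \<le> u \<longrightarrow> v \<le> 1 \<longrightarrow> (\<forall>z\<in>topspace Z. proj z = c u \<longrightarrow>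
    (\<exists>w. continuous_map (top_of_set {u..v}) Z w \<and> w u = z \<and> (\<forall>r\<in>{u..v}. proj (w r) = c r))))"
    for u v :: real
  have "P 0 1"
  proof (rule Bolzano[of 0 1 P])
    fix u v x assume trans: "P u v" "P v x" "u \<le> v" "v \<le> x"
    show "P u x" unfolding P_def
    proof (intro impI ballI)
      fix z assume "0 \<le> u" "x \<le> 1" "z \<in> topspace Z" "proj z = c u"
      then obtain w where w: "continuous_map (top_of_set {u..v}) Z w" "w u = z"
          "\<forall>r\<in>{u..v}. proj (w r) = c r"
        using trans(1)[unfolded P_def, rule_format, of z] trans(3,4) by auto
      have "w v \<in> topspace Z"
        using continuous_map_image_subset_topspace[OF w(1)] \<open>u \<le> v\<close> by auto
      moreover have "proj (w v) = c v" using w \<open>u \<le> v\<close> by auto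
      ultimately obtain w' where w': "continuous_map (top_of_set {v..x}) Z w'" "w' v = w v"
          "\<forall>r\<in>{v..x}. proj (w' r) = c r"
        using trans(2)[unfolded P_def, rule_format, of "w v"] trans(3) \<open>0 \<le> u\<close> \<open>x \<le> 1\<close> by auto
      let ?w = "\<lambda>r. if r \<le> v then w r else w' r"
      have "continuous_map (top_of_set {u..x}) Z ?w"
      proof (rule continuous_map_cases_le)
        have "{u..x} \<inter> {r. r \<in> {u..x} \<and> r \<le> v} = {u..v}"
          "{u..x} \<inter> {r. r \<in> {u..x} \<and> v \<le> r} = {v..x}"
          using trans by auto
        then show "continuous_map (subtopology (top_of_set {u..x})
              {r \<in> topspace (top_of_set {u..x}). r \<le> v}) Z w"
          "continuous_map (subtopology (top_of_set {u..x})
              {r \<in> topspace (top_of_set {u..x}). v \<le> r}) Z w'"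
          using w w' by (simp_all add: subtopology_subtopology)
      qed (use w' in auto)
      then show "\<exists>w. continuous_map (top_of_set {u..x}) Z w \<and> w u = z \<and>
          (\<forall>r\<in>{u..x}. proj (w r) = c r)"
        using w w' \<open>u \<le> v\<close> by (intro exI[of _ ?w]) auto
    qed
  next
    fix x :: real assume local: "0 \<le> x" "x \<le> 1"
    have "c x \<in> topspace quot"
      using c local continuous_map_image_subset_topspace unfolding pathin_def by fastforce
    then obtain z0 where z0: "z0 \<in> topspace Z" "c x = proj z0"
      by (auto simp: topspace_quot)
    then obtain U where U: "wandering U" "z0 \<in> U" using wandering_neighbourhood by blast
    let ?V = "proj ` U"
    obtain \<sigma> where \<sigma>: "homeomorphic_maps (subtopology Z U) (subtopology quot ?V) proj \<sigma>"
      using local_section[OF U(1)] .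
    have sub: "U \<subseteq> topspace Z" using U by (simp add: wandering_def openin_subset)
    have \<sigma>c: "continuous_map (subtopology quot ?V) Z \<sigma>"
      and \<sigma>U: "\<And>y. y \<in> ?V \<Longrightarrow> \<sigma> y \<in> U" and \<sigma>p: "\<And>y. y \<in> ?V \<Longrightarrow> proj (\<sigma> y) = y"
      using \<sigma> sub unfolding homeomorphic_maps_def continuous_map_in_subtopology
      by (auto simp: topspace_quot)
    have "openin (top_of_set {0..1}) {r \<in> {0..1}. c r \<in> ?V}"
      using openin_continuous_map_preimage[OF c[unfolded pathin_def]] open_map_proj U
      by (auto simp: wandering_def open_map_def)
    moreover have "x \<in> {r \<in> {0..1}. c r \<in> ?V}"
      using z0 U local by auto
    ultimately have "\<exists>d>0. \<forall>r\<in>{0..1}. dist r x < d \<longrightarrow> r \<in> {r \<in> {0..1}. c r \<in> ?V}"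
      unfolding openin_euclidean_subtopology_iff by (elim conjE) (rule bspec)
    then obtain d where d: "d > 0" "\<And>r. r \<in> {0..1} \<Longrightarrow> dist r x < d \<Longrightarrow> c r \<in> ?V"
      by auto
    have "P u v" if uv: "u \<le> x" "x \<le> v" "v - u < d" for u v
      unfolding P_def
    proof (intro impI ballI)
      fix z assume *: "0 \<le> u" "v \<le> 1" and z: "z \<in> topspace Z" "proj z = c u"
      have V: "c r \<in> ?V" if "r \<in> {u..v}" for r
        using that uv * by (intro d(2)) (auto simp: dist_real_def)
      have u: "\<sigma> (c u) \<in> topspace Z" "proj (\<sigma> (c u)) = proj z"
        using V[of u] uv \<sigma>U \<sigma>p sub z by auto
      then obtain \<gamma> where \<gamma>: "\<gamma> \<in> carrier \<Gamma>" "z = a \<gamma> (\<sigma> (c u))"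
        using proj_eq_iff z by blast
      have "continuous_map (top_of_set {u..v}) (subtopology quot ?V) c"
        using c V * unfolding pathin_def continuous_map_in_subtopology
        by (auto intro: continuous_map_from_subtopology_mono)
      then have "continuous_map (top_of_set {u..v}) Z (a \<gamma> \<circ> (\<sigma> \<circ> c))"
        using \<sigma>c continuous[OF \<gamma>(1)] by (intro continuous_map_compose)
      moreover have "\<forall>r\<in>{u..v}. proj (a \<gamma> (\<sigma> (c r))) = c r"
        using V \<sigma>U \<sigma>p sub \<gamma> by (metis proj_act subsetD)
      ultimately show "\<exists>w. continuous_map (top_of_set {u..v}) Z w \<and> w u = z \<and>
          (\<forall>r\<in>{u..v}. proj (w r) = c r)"
        using \<gamma> by (intro exI[of _ "a \<gamma> \<circ> (\<sigma> \<circ> c)"]) auto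
    qed
    with d(1) show "\<exists>d>0. \<forall>u v. u \<le> x \<and> x \<le> v \<and> v - u < d \<longrightarrow> P u v" by blast
  qed simp
  with z that show thesis
    unfolding P_def pathin_def by (auto 0 3)
qed

end

section \<open>Paths in topological groups and loops\<close>

lemma continuous_map_group_mult:
  assumes "topological_group G T" "continuous_map Z T f" "continuous_map Z T g"
  shows "continuous_map Z T (\<lambda>z. f z \<otimes>\<^bsub>G\<^esub> g z)"
proof -
  have "continuous_map Z T ((\<lambda>(x, y). x \<otimes>\<^bsub>G\<^esub> y) \<circ> (\<lambda>z. (f z, g z)))"
    using assms unfolding topological_group_def
    by (intro continuous_map_compose[of _ "prod_topology T T"] continuous_map_pairedI) auto
  then show ?thesis by (simp add: o_def)
qed

lemma continuous_map_group_inv: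
  assumes "topological_group G T" "continuous_map Z T f"
  shows "continuous_map Z T (\<lambda>z. inv\<^bsub>G\<^esub> f z)"
proof -
  have "continuous_map Z T ((\<lambda>x. inv\<^bsub>G\<^esub> x) \<circ> f)"
    using assms unfolding topological_group_def by (intro continuous_map_compose[of _ T]) auto
  then show ?thesis by (simp add: o_def)
qed

lemma subgroup_identity_path_component:
  fixes G (structure)
  assumes top: "topological_group G T"
  shows "subgroup (identity_path_component G T) G"
proof -
  interpret group G using top by (simp add: topological_group_def)
  have T: "topspace T = carrier G" using top by (simp add: topological_group_def)
  show ?thesis
  proof
    show "identity_path_component G T \<subseteq> carrier G"
      by (auto simp: identity_path_component_def)
    show "\<one> \<in> identity_path_component G T"
      using T by (auto simp: identity_path_component_def pathin_def intro!: exI[of _ "\<lambda>_. \<one>"])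
  next
    fix x y assume "x \<in> identity_path_component G T" "y \<in> identity_path_component G T"
    then obtain p q where "pathin T p" "p 0 = \<one>" "p 1 = x" "pathin T q" "q 0 = \<one>" "q 1 = y"
      "x \<in> carrier G" "y \<in> carrier G"
      by (auto simp: identity_path_component_def)
    then show "x \<otimes> y \<in> identity_path_component G T"
      using continuous_map_group_mult[OF top, of _ p q]
      by (auto simp: identity_path_component_def pathin_def intro!: exI[of _ "\<lambda>t. p t \<otimes> q t"])
  next
    fix x assume "x \<in> identity_path_component G T"
    then obtain p where "pathin T p" "p 0 = \<one>" "p 1 = x" "x \<in> carrier G"
      by (auto simp: identity_path_component_def)
    then show "inv x \<in> identity_path_component G T"
      using continuous_map_group_inv[OF top, of _ p]
      by (auto simp: identity_path_component_def pathin_def intro!: exI[of _ "\<lambda>t. inv p t"])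
  qed
qed

lemma identity_path_component_if_path_to_translate:
  fixes G (structure)
  assumes top: "topological_group G T" and u: "pathin T u" and k: "k \<in> carrier G"
    and eq: "u 1 = k \<otimes> u 0"
  shows "k \<in> identity_path_component G T"
proof -
  interpret group G using top by (simp add: topological_group_def)
  have T: "topspace T = carrier G" using top by (simp add: topological_group_def)
  have u0: "u 0 \<in> carrier G"
    using continuous_map_image_subset_topspace[OF u[unfolded pathin_def]] T by auto
  have "pathin T (\<lambda>t. u t \<otimes> inv u 0)"
    using u u0 T unfolding pathin_def by (intro continuous_map_group_mult[OF top]) auto
  then show ?thesis
    using u0 k eq unfolding identity_path_component_def
    by (auto intro!: exI[of _ "\<lambda>t. u t \<otimes> inv u 0"] simp: m_assoc)
qed

lemma eq_one_if_pi0_mon: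
  assumes top: "topological_group G T" and "group \<Gamma>" and \<phi>: "\<phi> \<in> hom \<Gamma> G"
    and mon: "pi0_proj G T \<circ> \<phi> \<in> mon \<Gamma> (pi0_group G T)"
    and \<gamma>: "\<gamma> \<in> carrier \<Gamma>" "\<phi> \<gamma> \<in> identity_path_component G T"
  shows "\<gamma> = \<one>\<^bsub>\<Gamma>\<^esub>"
proof -
  interpret G: group G using top by (simp add: topological_group_def)
  interpret \<Gamma>: group \<Gamma> by fact
  interpret \<phi>: group_hom \<Gamma> G \<phi> by unfold_locales (rule \<phi>)
  note sub = subgroup_identity_path_component[OF top]
  have "(pi0_proj G T \<circ> \<phi>) \<gamma> = (pi0_proj G T \<circ> \<phi>) \<one>\<^bsub>\<Gamma>\<^esub>"
    using \<gamma> sub subgroup.one_closed[OF sub] by (simp add: pi0_proj_def G.coset_join2)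
  moreover have "inj_on (pi0_proj G T \<circ> \<phi>) (carrier \<Gamma>)"
    using mon by (simp add: mon_def)
  ultimately show ?thesis
    using \<gamma>(1) \<Gamma>.one_closed by (metis inj_onD)
qed

lemma quotient_map_cis: "quotient_map (top_of_set {0..1}) circle (\<lambda>t. cis (2 * pi * t))"
proof (rule continuous_imp_quotient_map)
  show "continuous_map (top_of_set {0..1}) circle (\<lambda>t. cis (2 * pi * t))"
    by (auto simp: continuous_map_in_subtopology intro!: continuous_intros)
  show "compact_space (top_of_set {0..1::real})"
    by (simp add: compact_space_subtopology)
  show "Hausdorff_space circle"
    by (simp add: Hausdorff_space_subtopology)
  have "z \<in> (\<lambda>t. cis (2 * pi * t)) ` {0..1}" if z: "cmod z = 1" for z
  proof -
    obtain t where "0 \<le> t" "t < 2 * pi" "z = Complex (cos t) (sin t)"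
      using complex_unimodular_polar[OF z] .
    then show ?thesis
      by (intro image_eqI[of _ _ "t / (2 * pi)"]) (auto simp: cis_conv_exp complex_eq_iff Re_exp Im_exp)
  qed
  then show "(\<lambda>t. cis (2 * pi * t)) ` topspace (top_of_set {0..1}) = topspace circle"
    by auto
qed

lemma loop_on_circle:
  assumes "pathin X q" "q 0 = q 1"
  obtains f where "continuous_map circle X f" "\<And>t. t \<in> {0..1} \<Longrightarrow> f (cis (2 * pi * t)) = q t"
proof (rule quotient_map_lift_exists[OF quotient_map_cis assms(1)[unfolded pathin_def]])
  fix s t :: real
  assume st: "s \<in> topspace (top_of_set {0..1})" "t \<in> topspace (top_of_set {0..1})"
    and "cis (2 * pi * s) = cis (2 * pi * t)"
  then obtain n :: int where "\<i> * complex_of_real (2 * pi * s) =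
      \<i> * complex_of_real (2 * pi * t) + of_int (2 * n) * pi * \<i>"
    by (auto simp only: cis_conv_exp exp_eq)
  then have "2 * pi * s = 2 * pi * t + 2 * n * pi"
    by (auto simp: complex_eq_iff)
  then have "2 * pi * s = 2 * pi * (t + n)"
    by (simp add: algebra_simps)
  then have n: "s = t + n" by simp
  then have "n = 0 \<or> n = 1 \<or> n = -1" using st by auto
  then show "q s = q t" using n st assms(2) by auto
next
  fix f assume "continuous_map circle X f"
    and "\<And>t. t \<in> topspace (top_of_set {0..1}) \<Longrightarrow> f (cis (2 * pi * t)) = q t"
  then show thesis by (intro that) auto
qed

section \<open>The associated bundle\<close>

locale associated_bundle_data =
  base: properly_discontinuous_action \<Gamma> X a
  for \<Gamma> :: "('c, 'n) monoid_scheme" and X :: "'x topology" and a +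
  fixes G :: "('g, 'm) monoid_scheme" and T :: "'g topology" and \<phi> :: "'c \<Rightarrow> 'g"
  assumes top: "topological_group G T" and hom: "\<phi> \<in> hom \<Gamma> G"
begin

sublocale G: group G using top by (simp add: topological_group_def)
sublocale \<phi>: group_hom \<Gamma> G \<phi> by unfold_locales (rule hom)

lemma topspace_T [simp]: "topspace T = carrier G"
  using top by (simp add: topological_group_def)

lemma act_closed: "\<gamma> \<in> carrier \<Gamma> \<Longrightarrow> x \<in> topspace X \<Longrightarrow> a \<gamma> x \<in> topspace X"
  using base.element_image by blast

lemma diag_action_apply:
  "x \<in> topspace X \<Longrightarrow> g \<in> carrier G \<Longrightarrow> diag_action G X a \<phi> \<gamma> (x, g) = (a \<gamma> x, \<phi> \<gamma> \<otimes>\<^bsub>G\<^esub> g)"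
  by (simp add: diag_action_def)

sublocale total: properly_discontinuous_action \<Gamma> "prod_topology X T" "diag_action G X a \<phi>"
proof (intro properly_discontinuous_action.intro properly_discontinuous_action_axioms.intro)
  show "group_action \<Gamma> (topspace (prod_topology X T)) (diag_action G X a \<phi>)"
    by (rule group_actionI)
      (auto simp: diag_action_apply act_closed base.act_one base.composition_rule G.m_assoc
        base.\<Gamma>.is_group, simp add: diag_action_def)
  show "continuous_map (prod_topology X T) (prod_topology X T) (diag_action G X a \<phi> \<gamma>)"
    if \<gamma>: "\<gamma> \<in> carrier \<Gamma>" for \<gamma>
  proof (rule continuous_map_eq)
    show "continuous_map (prod_topology X T) (prod_topology X T)
        (\<lambda>p. ((a \<gamma> \<circ> fst) p, \<phi> \<gamma> \<otimes>\<^bsub>G\<^esub> snd p))"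
      using \<gamma> base.continuous[OF \<gamma>]
      by (intro continuous_map_pairedI continuous_map_group_mult[OF top] continuous_map_snd
          continuous_map_compose[OF continuous_map_fst]) auto
  qed (auto simp: diag_action_apply)
  show "properly_discontinuous \<Gamma> (prod_topology X T) (diag_action G X a \<phi>)"
    unfolding properly_discontinuous_def
  proof
    fix p assume "p \<in> topspace (prod_topology X T)"
    then have p: "fst p \<in> topspace X" "snd p \<in> carrier G" by auto
    obtain U where U: "base.wandering U" "fst p \<in> U"
      using base.wandering_neighbourhood[OF p(1)] .
    then have "U \<subseteq> topspace X" by (simp add: base.wandering_def openin_subset)
    then have "diag_action G X a \<phi> \<gamma> ` (U \<times> carrier G) \<subseteq> a \<gamma> ` U \<times> UNIV" for \<gamma>
      by (auto simp: diag_action_apply)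
    moreover have "openin (prod_topology X T) (U \<times> carrier G)"
      using U openin_topspace[of T] by (simp add: openin_prod_Times_iff base.wandering_def)
    ultimately show "\<exists>U. openin (prod_topology X T) U \<and> p \<in> U \<and>
        (\<forall>\<gamma>\<in>carrier \<Gamma>. \<gamma> \<noteq> \<one>\<^bsub>\<Gamma>\<^esub> \<longrightarrow> diag_action G X a \<phi> \<gamma> ` U \<inter> U = {})"
      using U p unfolding base.wandering_def
      by (intro exI[of _ "U \<times> carrier G"]) (auto simp: mem_Times_iff, blast+)
  qed
qed

lemma total_proj_Pair:
  assumes "x \<in> topspace X" "g \<in> carrier G"
  shows "total.proj (x, g) = {(a \<gamma> x, \<phi> \<gamma> \<otimes>\<^bsub>G\<^esub> g) |\<gamma>. \<gamma> \<in> carrier \<Gamma>}"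
  using assms by (simp add: orbit_def diag_action_apply)

lemma fst_image_total_proj:
  assumes "x \<in> topspace X" "g \<in> carrier G"
  shows "fst ` total.proj (x, g) = base.proj x"
  by (subst total_proj_Pair[OF assms]) (force simp: orbit_def)

lemma translate_total_proj:
  assumes "x \<in> topspace X" "g \<in> carrier G" "k \<in> carrier G"
  shows "(\<lambda>(x, g). (x, g \<otimes>\<^bsub>G\<^esub> k)) ` total.proj (x, g) = total.proj (x, g \<otimes>\<^bsub>G\<^esub> k)"
  using assms by (force simp: total_proj_Pair G.m_assoc)

abbreviation P where "P \<equiv> associated_bundle \<Gamma> G T X a \<phi>"

lemma P_simps [simp]:
  "total_space P = total.quot" "base_space P = base.quot" "bundle_proj P S = fst ` S"
  "right_act P S k = (\<lambda>(x, g). (x, g \<otimes>\<^bsub>G\<^esub> k)) ` S"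
  by (simp_all add: associated_bundle_def)

lemma continuous_map_bundle_proj: "continuous_map total.quot base.quot (image fst)"
proof (rule continuous_compose_quotient_map[OF total.quotient_map_proj])
  show "continuous_map (prod_topology X T) base.quot (image fst \<circ> total.proj)"
    by (rule continuous_map_eq[OF continuous_map_compose[OF continuous_map_fst base.continuous_map_proj]])
      (clarsimp simp: fst_image_total_proj)
qed

lemma continuous_map_right_act:
  "continuous_map (prod_topology total.quot T) total.quot
     (\<lambda>(S, k). (\<lambda>(x, g). (x, g \<otimes>\<^bsub>G\<^esub> k)) ` S)"
proof -
  let ?XTT = "prod_topology (prod_topology X T) T"
  have "quotient_map ?XTT (prod_topology total.quot T) (\<lambda>(p, k). (total.proj p, k))"
  proof (rule continuous_open_imp_quotient_map)
    have "continuous_map ?XTT (prod_topology total.quot T) (\<lambda>p. ((total.proj \<circ> fst) p, snd p))"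
      by (intro continuous_map_pairedI continuous_map_snd
          continuous_map_compose[OF continuous_map_fst total.continuous_map_proj])
    then show "continuous_map ?XTT (prod_topology total.quot T) (\<lambda>(p, k). (total.proj p, k))"
      by (simp add: case_prod_unfold)
    show "open_map ?XTT (prod_topology total.quot T) (\<lambda>(p, k). (total.proj p, k))"
      by (rule open_map_prod_left[OF total.open_map_proj])
  qed (auto simp: total.topspace_quot image_iff)
  then show ?thesis
  proof (rule continuous_compose_quotient_map)
    have "continuous_map ?XTT (prod_topology X T)
        (\<lambda>p. ((fst \<circ> fst) p, (snd \<circ> fst) p \<otimes>\<^bsub>G\<^esub> snd p))"
      by (intro continuous_map_pairedI continuous_map_group_mult[OF top] continuous_map_snd
          continuous_map_compose[OF continuous_map_fst continuous_map_fst]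
          continuous_map_compose[OF continuous_map_fst continuous_map_snd])
    from continuous_map_compose[OF this total.continuous_map_proj]
    show "continuous_map ?XTT total.quot
        ((\<lambda>(S, k). (\<lambda>(x, g). (x, g \<otimes>\<^bsub>G\<^esub> k)) ` S) \<circ> (\<lambda>(p, k). (total.proj p, k)))"
      by (rule continuous_map_eq) (clarsimp simp: translate_total_proj)
  qed
qed

lemma trivial_over_wandering:
  assumes U: "base.wandering U"
  shows "trivial_bundle G T (restrict_bundle P (base.proj ` U))"
proof -
  let ?V = "base.proj ` U"
  let ?BV = "subtopology base.quot ?V"
  let ?EV = "subtopology total.quot {e. fst ` e \<in> ?V}"
  have sub: "U \<subseteq> topspace X" using U by (simp add: base.wandering_def openin_subset)
  obtain \<sigma> where \<sigma>: "homeomorphic_maps (subtopology X U) ?BV base.proj \<sigma>"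
    using base.local_section[OF U] .
  have BV: "topspace ?BV = ?V" using sub by (auto simp: base.topspace_quot)
  have \<sigma>U: "\<sigma> y \<in> U" and \<sigma>p: "base.proj (\<sigma> y) = y" if "y \<in> ?V" for y
    using \<sigma> sub that unfolding homeomorphic_maps_def continuous_map_in_subtopology
    by (auto simp: base.topspace_quot)
  have \<sigma>p': "\<sigma> (base.proj x) = x" if "x \<in> U" for x
    using \<sigma> sub that unfolding homeomorphic_maps_def by auto
  have \<sigma>X: "\<sigma> y \<in> topspace X" if "y \<in> ?V" for y using \<sigma>U that sub by blast
  define h where "h = total.proj \<circ> (\<lambda>(y, g). (\<sigma> y, g))"
  have h: "h (y, g) = total.proj (\<sigma> y, g)" for y g by (simp add: h_def)
  have "homeomorphic_map (prod_topology ?BV T) ?EV h"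
  proof (rule bijective_open_imp_homeomorphic_map)
    have "continuous_map ?BV X \<sigma>"
      using \<sigma> unfolding homeomorphic_maps_def continuous_map_in_subtopology by blast
    from continuous_map_compose[OF continuous_map_fst this]
    have "continuous_map (prod_topology ?BV T) (prod_topology X T) (\<lambda>p. ((\<sigma> \<circ> fst) p, snd p))"
      by (intro continuous_map_pairedI continuous_map_snd)
    then have "continuous_map (prod_topology ?BV T) (prod_topology X T) (\<lambda>(y, g). (\<sigma> y, g))"
      by (simp add: case_prod_unfold)
    then have "continuous_map (prod_topology ?BV T) total.quot h"
      unfolding h_def by (rule continuous_map_compose[OF _ total.continuous_map_proj])
    then show "continuous_map (prod_topology ?BV T) ?EV h"
      by (auto simp: continuous_map_in_subtopology h BV fst_image_total_proj \<sigma>X \<sigma>p)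
    have "open_map ?BV (subtopology X U) \<sigma>"
      using \<sigma> homeomorphic_imp_open_map homeomorphic_maps_map by blast
    then have "open_map ?BV X \<sigma>"
      using U by (simp add: open_map_in_subtopology base.wandering_def)
    then have "open_map (prod_topology ?BV T) total.quot h"
      unfolding h_def by (intro open_map_compose[OF _ total.open_map_proj] open_map_prod_left)
    then show "open_map (prod_topology ?BV T) ?EV h"
      by (rule open_map_into_subtopology) (auto simp: h BV fst_image_total_proj \<sigma>X \<sigma>p)
    show "h ` topspace (prod_topology ?BV T) = topspace ?EV"
    proof
      show "h ` topspace (prod_topology ?BV T) \<subseteq> topspace ?EV"
        by (auto simp: h BV total.topspace_quot fst_image_total_proj \<sigma>X \<sigma>p simp del: topspace_subtopology)
          (auto simp: total.topspace_quot fst_image_total_proj \<sigma>X \<sigma>p)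
      show "topspace ?EV \<subseteq> h ` topspace (prod_topology ?BV T)"
      proof
        fix e assume "e \<in> topspace ?EV"
        then obtain x g where e: "x \<in> topspace X" "g \<in> carrier G" "e = total.proj (x, g)"
            "base.proj x \<in> ?V"
          by (auto simp: total.topspace_quot fst_image_total_proj)
        then obtain \<gamma> where \<gamma>: "\<gamma> \<in> carrier \<Gamma>" "\<sigma> (base.proj x) = a \<gamma> x"
          using base.proj_eq_iff[of x "\<sigma> (base.proj x)"] \<sigma>X \<sigma>p by metis
        have "h (base.proj x, \<phi> \<gamma> \<otimes>\<^bsub>G\<^esub> g) = e"
          using total.proj_act[of \<gamma> "(x, g)"] e \<gamma> by (simp add: h diag_action_apply)
        then show "e \<in> h ` topspace (prod_topology ?BV T)"
          using e \<gamma> by (intro image_eqI[of _ _ "(base.proj x, \<phi> \<gamma> \<otimes>\<^bsub>G\<^esub> g)"]) (simp_all add: BV del: topspace_subtopology)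
      qed
    qed
    show "inj_on h (topspace (prod_topology ?BV T))"
    proof (rule inj_onI)
      fix p q assume "p \<in> topspace (prod_topology ?BV T)" "q \<in> topspace (prod_topology ?BV T)"
        and eq: "h p = h q"
      then obtain y g z k where p: "p = (y, g)" "y \<in> ?V" "g \<in> carrier G"
        and q: "q = (z, k)" "z \<in> ?V" "k \<in> carrier G"
        by (cases p, cases q) (simp add: BV del: topspace_subtopology)
      have yz: "y = z"
        using arg_cong[OF eq, of "image fst"] p q by (simp add: h fst_image_total_proj \<sigma>X \<sigma>p)
      obtain \<gamma> where \<gamma>: "\<gamma> \<in> carrier \<Gamma>" "(\<sigma> z, k) = (a \<gamma> (\<sigma> y), \<phi> \<gamma> \<otimes>\<^bsub>G\<^esub> g)"
        using total.proj_eq_iff[of "(\<sigma> y, g)" "(\<sigma> z, k)"] eq p q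
        by (auto simp: h \<sigma>X diag_action_apply)
      then have "a \<gamma> ` U \<inter> U \<noteq> {}"
        using \<sigma>U[OF p(2)] yz by auto
      then have "\<gamma> = \<one>\<^bsub>\<Gamma>\<^esub>" using U \<gamma>(1) unfolding base.wandering_def by blast
      then show "p = q" using \<gamma> p q yz by simp
    qed
  qed
  then show ?thesis
    unfolding trivial_bundle_def restrict_bundle_def
    by (intro exI[of _ h])
      (auto simp: h fst_image_total_proj translate_total_proj \<sigma>X \<sigma>p BV
        simp del: topspace_subtopology)
qed

lemma principal: "principal_bundle G T P"
  unfolding principal_bundle_def
proof (intro conjI ballI)
  show "continuous_map (total_space P) (base_space P) (bundle_proj P)"
    using continuous_map_bundle_proj by (simp add: associated_bundle_def)
  show "continuous_map (prod_topology (total_space P) T) (total_space P) (\<lambda>(e, g). right_act P e g)"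
    using continuous_map_right_act by simp
next
  fix e assume "e \<in> topspace (total_space P)"
  then obtain x g where e: "x \<in> topspace X" "g \<in> carrier G" "e = total.proj (x, g)"
    by (auto simp: total.topspace_quot)
  show "right_act P e \<one>\<^bsub>G\<^esub> = e"
    using e by (simp add: translate_total_proj)
  fix k assume k: "k \<in> carrier G"
  show "bundle_proj P (right_act P e k) = bundle_proj P e"
    using e k by (simp add: translate_total_proj fst_image_total_proj)
  fix k' assume "k' \<in> carrier G"
  then show "right_act P (right_act P e k) k' = right_act P e (k \<otimes>\<^bsub>G\<^esub> k')"
    using e k by (simp add: translate_total_proj G.m_assoc)
next
  fix b assume "b \<in> topspace (base_space P)"
  then obtain x where x: "x \<in> topspace X" "b = base.proj x"
    by (auto simp: base.topspace_quot)
  then obtain U where U: "base.wandering U" "x \<in> U"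
    using base.wandering_neighbourhood by blast
  then have "openin base.quot (base.proj ` U)"
    using base.open_map_proj by (simp add: base.wandering_def open_map_def)
  then show "\<exists>U. openin (base_space P) U \<and> b \<in> U \<and> trivial_bundle G T (restrict_bundle P U)"
    using U x trivial_over_wandering[OF U(1)] by (intro exI[of _ "base.proj ` U"]) simp
qed (rule top)

lemma path_lift_if_trivial_pullback:
  assumes triv: "trivial_bundle G T (pullback_bundle circle f P)"
  obtains q \<gamma> where "pathin X q" "\<And>t. t \<in> {0..1} \<Longrightarrow> base.proj (q t) = f (cis (2 * pi * t))"
    "\<gamma> \<in> carrier \<Gamma>" "q 1 = a \<gamma> (q 0)" "\<phi> \<gamma> \<in> identity_path_component G T"
proof -
  let ?E = "subtopology (prod_topology circle total.quot) {(c, e). f c = fst ` e}"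
  obtain h where h: "homeomorphic_map (prod_topology circle T) ?E h"
    and hf: "\<And>c g. c \<in> topspace circle \<Longrightarrow> g \<in> carrier G \<Longrightarrow> fst (h (c, g)) = c"
    using triv unfolding trivial_bundle_def pullback_bundle_def by auto
  define s where "s = (\<lambda>c. snd (h (c, \<one>\<^bsub>G\<^esub>)))"
  have hc: "continuous_map (prod_topology circle T) ?E h"
    using h homeomorphic_imp_continuous_map by blast
  have "continuous_map circle (prod_topology circle T) (\<lambda>c. (c, \<one>\<^bsub>G\<^esub>))"
    by (intro continuous_map_pairedI) auto
  from continuous_map_compose[OF this hc]
  have hs: "continuous_map circle ?E (\<lambda>c. h (c, \<one>\<^bsub>G\<^esub>))" by (simp add: o_def)
  then have s: "continuous_map circle total.quot s"
    unfolding s_def continuous_map_in_subtopology by (auto simp: continuous_map_pairwise o_def)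
  have sf: "fst ` s c = f c" if "c \<in> topspace circle" for c
  proof -
    have "h (c, \<one>\<^bsub>G\<^esub>) \<in> topspace ?E"
      using continuous_map_image_subset_topspace[OF hs] that by blast
    with hf[OF that G.one_closed] show ?thesis
      unfolding s_def by (cases "h (c, \<one>\<^bsub>G\<^esub>)") simp
  qed
  have "pathin total.quot (s \<circ> (\<lambda>t. cis (2 * pi * t)))"
    unfolding pathin_def
    by (rule continuous_map_compose[OF quotient_imp_continuous_map[OF quotient_map_cis] s])
  moreover have "s 1 \<in> topspace total.quot"
    using continuous_map_image_subset_topspace[OF s] by auto
  then obtain z where z: "z \<in> topspace (prod_topology X T)" "total.proj z = s 1"
    by (auto simp: total.topspace_quot)
  ultimately obtain w where w: "pathin (prod_topology X T) w" "w 0 = z"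
      "\<And>t. t \<in> {0..1} \<Longrightarrow> total.proj (w t) = s (cis (2 * pi * t))"
    using total.path_lifting[of "s \<circ> (\<lambda>t. cis (2 * pi * t))" z] by auto
  have wT: "w t \<in> topspace X \<times> carrier G" if "t \<in> {0..1}" for t
    using continuous_map_image_subset_topspace[OF w(1)[unfolded pathin_def]] that by auto
  have "total.proj (w 0) = total.proj (w 1)"
    using w(3)[of 0] w(3)[of 1] by simp
  then obtain \<gamma> where \<gamma>: "\<gamma> \<in> carrier \<Gamma>" "w 1 = diag_action G X a \<phi> \<gamma> (w 0)"
    using total.proj_eq_iff[of "w 0" "w 1"] wT by auto
  then have 1: "fst (w 1) = a \<gamma> (fst (w 0))" "snd (w 1) = \<phi> \<gamma> \<otimes>\<^bsub>G\<^esub> snd (w 0)"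
    using wT[of 0] by (auto simp: diag_action_def)
  show thesis
  proof (rule that[of "fst \<circ> w" \<gamma>])
    show "pathin X (fst \<circ> w)" by (rule pathin_compose[OF w(1) continuous_map_fst])
    show "base.proj ((fst \<circ> w) t) = f (cis (2 * pi * t))" if "t \<in> {0..1}" for t
      using w(3)[OF that] wT[OF that] sf[of "cis (2 * pi * t)"]
        fst_image_total_proj[of "fst (w t)" "snd (w t)"]
      by (simp add: mem_Times_iff)
    show "\<phi> \<gamma> \<in> identity_path_component G T"
      using identity_path_component_if_path_to_translate
        [OF top pathin_compose[OF w(1) continuous_map_snd]] 1 \<gamma> by simp
  qed (use \<gamma> 1 in auto)
qed

lemma nullhomotopic_if_lifts_to_loop:
  assumes "simply_connected_space X" and q: "pathin X q" "q 0 = q 1"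
    and lift: "\<And>t. t \<in> {0..1} \<Longrightarrow> base.proj (q t) = f (cis (2 * pi * t))"
    and f: "continuous_map circle base.quot f"
  shows "nullhomotopic circle base.quot f"
proof -
  obtain k where k: "continuous_map circle X k" "\<And>t. t \<in> {0..1} \<Longrightarrow> k (cis (2 * pi * t)) = q t"
    using loop_on_circle[OF q] by blast
  then obtain x where "homotopic_with (\<lambda>_. True) circle X k (\<lambda>_. x)"
    using assms(1) unfolding simply_connected_space_def nullhomotopic_def by blast
  then have "homotopic_with (\<lambda>_. True) circle base.quot (base.proj \<circ> k) (base.proj \<circ> (\<lambda>_. x))"
    by (rule homotopic_with_compose_continuous_map_left[OF _ base.continuous_map_proj]) simp
  moreover have "homotopic_with (\<lambda>_. True) circle base.quot f (base.proj \<circ> k)"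
  proof (rule homotopic_with_equal)
    fix c :: complex assume "c \<in> topspace circle"
    moreover have "(\<lambda>t. cis (2 * pi * t)) ` {0..1} = topspace circle"
      using quotient_imp_surjective_map[OF quotient_map_cis] by simp
    ultimately obtain t where "t \<in> {0..1}" "c = cis (2 * pi * t)"
      by blast
    then show "f c = (base.proj \<circ> k) c" using lift k by simp
  qed (use f in auto)
  ultimately have "homotopic_with (\<lambda>_. True) circle base.quot f (base.proj \<circ> (\<lambda>_. x))"
    by (rule homotopic_with_trans[rotated])
  then show ?thesis unfolding nullhomotopic_def o_def by blast
qed

end

theorem lemma1p11:
  fixes X :: "'x topology"
    and G :: "('g, 'm) monoid_scheme" and T :: "'g topology"
    and \<Gamma> :: "('c, 'n) monoid_scheme" and a :: "'c \<Rightarrow> 'x \<Rightarrow> 'x"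
    and \<phi> :: "'c \<Rightarrow> 'g"
  assumes "simply_connected_space X" and "locally_path_connected_space X" and "Hausdorff_space X"
    and "topological_group G T" and "compact_space T" and "Hausdorff_space T"
    and "group \<Gamma>" and "continuous_action \<Gamma> X a"
    and "free_action \<Gamma> X a" and "properly_discontinuous \<Gamma> X a"
    and "\<phi> \<in> hom \<Gamma> G"
    and "pi0_proj G T \<circ> \<phi> \<in> mon \<Gamma> (pi0_group G T)"
  shows "incompressible_bundle G T (associated_bundle \<Gamma> G T X a \<phi>)"
proof -
  interpret group_action \<Gamma> "topspace X" a
    using \<open>continuous_action \<Gamma> X a\<close> by (simp add: continuous_action_def)
  interpret associated_bundle_data \<Gamma> X a G T \<phi>
    using assms by unfold_locales (auto simp: continuous_action_def)
  show ?thesis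
    unfolding incompressible_bundle_def
  proof (intro conjI allI impI notI)
    show "principal_bundle G T P" by (rule principal)
    fix f
    assume f: "continuous_map circle (base_space P) f \<and> \<not> nullhomotopic circle (base_space P) f"
      and "trivial_bundle G T (pullback_bundle circle f P)"
    then obtain q \<gamma> where q: "pathin X q"
        "\<And>t. t \<in> {0..1} \<Longrightarrow> base.proj (q t) = f (cis (2 * pi * t))"
      and \<gamma>: "\<gamma> \<in> carrier \<Gamma>" "q 1 = a \<gamma> (q 0)" "\<phi> \<gamma> \<in> identity_path_component G T"
      using path_lift_if_trivial_pullback by metis
    have "q 0 \<in> topspace X"
      using continuous_map_image_subset_topspace[OF q(1)[unfolded pathin_def]] by auto
    moreover have "\<gamma> = \<one>\<^bsub>\<Gamma>\<^esub>"
      using eq_one_if_pi0_mon[OF assms(4,7,11,12) \<gamma>(1,3)] .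
    ultimately have "q 0 = q 1" using \<gamma>(2) base.act_one by simp
    then have "nullhomotopic circle base.quot f"
      using nullhomotopic_if_lifts_to_loop[OF assms(1) q(1) _ q(2)] f by simp
    with f show False by simp
  qed
qed

end
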